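(* Let $X$ be a real normed space, let $\mathcal F$ be a directionally fine family of closed cones in $X$ and let $L\subset X$ be a locally compact cone. For each $\varepsilon\in(0,1)$ one can choose a finite union $D_L^\varepsilon$ of members of $\mathcal F$ such that \[ d_H(D_L^\varepsilon\cap S_X,B_L)\le2\varepsilon,\qquad d_H(D_L^\varepsilon\cap RB_X,L\cap RB_X)\le2R\varepsilon\quad\forall R>0. \] Consequently, $D_L^\varepsilon\cap S_X$ converges to $B_L$ and, for every $R>0$, $D_L^\varepsilon\cap RB_X$ converges to $L\cap RB_X$ in Hausdorff distance as $\varepsilon\downarrow0$.
   Context: $S_X$, $B_X$ are the unit sphere and closed unit ball, $B(x,r)=x+rB_X$, $\operatorname{cone}(A)=\{ta:t\ge0,\ a\in A\}$, $d(x,A)=\inf_{a\in A}\|x-a\|$. For nonempty closed bounded $A,B$, $d_H(A,B)=\max\{\sup_{a\in A}d(a,B),\sup_{b\in B}d(b,A)\}$. A nonempty set $C\subset X$ is a cone if $tC\subset C$ for every $t\ge 0$; all cones are assumed proper, i.e. $\{0_X\}\subsetneq C\subsetneq X$ (not necessarily convex). A family $\mathcal F$ of closed cones in $X$ is directionally fine if for every $u\in S_X$ and $\varepsilon\in(0,1)$ there exists $C\in\mathcal F$ with $u\in\operatorname{int}C\subset C\subset\operatorname{cone}B(u,\varepsilon)$. A cone $L$ is locally compact if for every $x\in L$ there is $r>0$ with $L\cap B(x,r)$ norm compact. $B_L:=L\cap S_X$ is the norm-base of $L$. *)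

theory Defs
  imports "HOL-Analysis.Analysis"
begin

text \<open>Cones are not required to be convex, but they are always proper:
  different from the zero cone and from the whole space.\<close>

definition proper_cone :: "'a::real_normed_vector set \<Rightarrow> bool" where
  "proper_cone C \<longleftrightarrow> cone C \<and> {0} \<subset> C \<and> C \<subset> UNIV"

definition cone_over :: "'a::real_normed_vector set \<Rightarrow> 'a set" where
  "cone_over A = {t *\<^sub>R a | t a. 0 \<le> t \<and> a \<in> A}"

text \<open>Meaningful only for nonempty bounded arguments: otherwise the real-valued suprema
  are unspecified, and \<^const>\<open>infdist\<close> to the empty set is 0.\<close>

definition hausdorff_dist :: "'a::metric_space set \<Rightarrow> 'a set \<Rightarrow> real" where
  "hausdorff_dist A B = max (SUP a\<in>A. infdist a B) (SUP b\<in>B. infdist b A)"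

definition directionally_fine :: "'a::real_normed_vector set set \<Rightarrow> bool" where
  "directionally_fine \<F> \<longleftrightarrow>
     (\<forall>C\<in>\<F>. proper_cone C \<and> closed C) \<and>
     (\<forall>u\<in>sphere 0 1. \<forall>\<epsilon>\<in>{0<..<1}. \<exists>C\<in>\<F>.
        u \<in> interior C \<and> interior C \<subseteq> C \<and> C \<subseteq> cone_over (cball u \<epsilon>))"

definition locally_compact_cone :: "'a::real_normed_vector set \<Rightarrow> bool" where
  "locally_compact_cone L \<longleftrightarrow>
     proper_cone L \<and> (\<forall>x\<in>L. \<exists>r>0. compact (L \<inter> cball x r))"

definition norm_base :: "'a::real_normed_vector set \<Rightarrow> 'a set" where
  "norm_base L = L \<inter> sphere 0 1"

text \<open>The empty union is excluded: it is not a cone, and Hausdorff distances to it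
  are not defined.\<close>

definition finite_union_of_members :: "'a set set \<Rightarrow> 'a set \<Rightarrow> bool" where
  "finite_union_of_members \<F> D \<longleftrightarrow> (\<exists>\<G>. finite \<G> \<and> \<G> \<noteq> {} \<and> \<G> \<subseteq> \<F> \<and> D = \<Union>\<G>)"

end

theory Submission
  imports Defs
begin

text \<open>The norm-base of a locally compact cone \<open>L\<close> is compact, being a rescaled slice of a
  compact neighbourhood of the apex. Hence it is covered by the interiors of finitely many members
  of the family, each contained in the cone over \<open>B(u, \<epsilon>)\<close> for some \<open>u\<close> in the norm-base.
  Their union \<open>D\<close> contains \<open>L\<close>, so only the excess of \<open>D\<close> over \<open>L\<close> matters. A unit vector
  in the cone over \<open>B(u, \<epsilon>)\<close> is the normalisation of a point \<open>\<epsilon>\<close>-close to \<open>u\<close>, and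
  normalising costs at most another \<open>\<epsilon>\<close>; scaling gives the estimate on balls.\<close>

text \<open>Provides the lower bound when the limits are squeezed. One of the two suprema in the
  maximum decides it: \<open>infdist\<close> is 1-Lipschitz in its point, so on a bounded set its
  values are bounded above and their real supremum dominates each of them.\<close>

lemma hausdorff_dist_nonneg:
  fixes A B :: "'a::metric_space set"
  assumes "bounded A" "A \<noteq> {}"
  shows "0 \<le> hausdorff_dist A B"
proof -
  obtain a where a: "a \<in> A" using assms by blast
  obtain M where M: "\<And>x. x \<in> A \<Longrightarrow> dist a x \<le> M"
    using assms(1) bounded_any_center[of A a] by blast
  have "infdist x B \<le> infdist a B + M" if "x \<in> A" for x
    using infdist_triangle[of x B a] M[OF that] by (simp add: dist_commute)
  then have "bdd_above ((\<lambda>x. infdist x B) ` A)"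
    by (auto intro!: bdd_aboveI2)
  then have "0 \<le> (SUP x\<in>A. infdist x B)"
    using a by (intro cSUP_upper2[where x = a]) (auto simp: infdist_nonneg)
  then show ?thesis by (simp add: hausdorff_dist_def)
qed

text \<open>Points of \<open>B\<close> lie in \<open>A\<close> and contribute distance 0, so only
  the excess of \<open>A\<close> over \<open>B\<close> has to be estimated.\<close>

lemma hausdorff_dist_superset_le:
  fixes A B :: "'a::metric_space set"
  assumes "B \<subseteq> A" "B \<noteq> {}" "0 \<le> e"
    and near: "\<And>a. a \<in> A \<Longrightarrow> \<exists>b\<in>B. dist a b \<le> e"
  shows "hausdorff_dist A B \<le> e"
proof -
  have "(SUP a\<in>A. infdist a B) \<le> e"
    using assms by (intro cSUP_least) (auto dest!: near intro: infdist_le2)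
  moreover have "(SUP b\<in>B. infdist b A) \<le> e"
    using assms by (intro cSUP_least) (auto simp: subset_iff)
  ultimately show ?thesis by (simp add: hausdorff_dist_def)
qed

lemma proper_cone_meets_sphere:
  assumes "proper_cone C"
  shows "C \<inter> sphere 0 1 \<noteq> {}"
proof -
  from assms obtain x where x: "x \<in> C" "x \<noteq> 0"
    by (auto simp: proper_cone_def)
  then have "(1 / norm x) *\<^sub>R x \<in> C"
    using assms by (intro mem_cone) (auto simp: proper_cone_def)
  then show ?thesis using x by force
qed

lemma proper_cone_meets_cball:
  assumes "proper_cone C" "0 \<le> R"
  shows "C \<inter> cball 0 R \<noteq> {}"
  using assms by (auto simp: proper_cone_def)

lemma cone_finite_union:
  assumes "finite_union_of_members \<F> D" "\<And>C. C \<in> \<F> \<Longrightarrow> cone C"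
  shows "cone D"
  using assms unfolding finite_union_of_members_def cone_def by blast

lemma compact_norm_base:
  fixes L :: "'a::real_normed_vector set"
  assumes "locally_compact_cone L"
  shows "compact (norm_base L)"
proof -
  have L: "cone L" "0 \<in> L"
    using assms by (auto simp: locally_compact_cone_def proper_cone_def)
  obtain r where r: "r > 0" "compact (L \<inter> cball 0 r)"
    using assms L by (auto simp: locally_compact_cone_def)
  \<comment> \<open>Keeping \<open>cball 0 r\<close> in the intersection displays the slice as a
    closed subset of the compact set given by local compactness at 0.\<close>
  have "norm_base L = (*\<^sub>R) (1 / r) ` (L \<inter> cball 0 r \<inter> sphere 0 r)"
  proof (intro equalityI subsetI)
    fix x assume x: "x \<in> norm_base L"
    then have "r *\<^sub>R x \<in> L \<inter> cball 0 r \<inter> sphere 0 r"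
      using L r by (auto simp: norm_base_def intro: mem_cone)
    moreover have "x = (1 / r) *\<^sub>R (r *\<^sub>R x)" using r by simp
    ultimately show "x \<in> (*\<^sub>R) (1 / r) ` (L \<inter> cball 0 r \<inter> sphere 0 r)" by blast
  next
    fix x assume "x \<in> (*\<^sub>R) (1 / r) ` (L \<inter> cball 0 r \<inter> sphere 0 r)"
    then show "x \<in> norm_base L"
      using L r by (auto simp: norm_base_def intro: mem_cone)
  qed
  also have "compact \<dots>"
    by (rule compact_scaling, rule compact_Int_closed[OF r(2)])
      (auto simp: sphere_def intro!: closed_Collect_eq continuous_intros)
  finally show ?thesis .
qed

lemma dist_cone_over_cball_sphere:
  fixes u :: "'a::real_normed_vector"
  assumes "norm u = 1" "norm a = 1" "a \<in> cone_over (cball u e)"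
  shows "dist a u \<le> 2 * e"
proof -
  obtain t b where tb: "0 \<le> t" "a = t *\<^sub>R b" "norm (u - b) \<le> e"
    using assms(3) by (auto simp: cone_over_def dist_norm)
  have t: "t * norm b = 1" using tb assms by simp
  \<comment> \<open>The points \<open>a\<close> and \<open>b\<close> lie on one ray, so their
    distance is the difference of their norms; as \<open>a\<close> and \<open>u\<close> both have
    norm 1, that difference is at most the distance from \<open>u\<close> to
    \<open>b\<close>.\<close>
  have "a - b = (t - 1) *\<^sub>R b" using tb by (simp add: algebra_simps)
  then have "norm (a - b) = \<bar>(t - 1) * norm b\<bar>" by (simp add: abs_mult)
  also have "\<dots> = \<bar>norm u - norm b\<bar>" using t assms by (simp add: algebra_simps)
  also have "\<dots> \<le> e" using norm_triangle_ineq3[of u b] tb by linarith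
  finally have "norm (a - b) \<le> e" .
  moreover have "norm (a - u) \<le> norm (a - b) + norm (b - u)"
    using norm_triangle_ineq[of "a - b" "b - u"] by simp
  ultimately show ?thesis using tb by (simp add: dist_norm norm_minus_commute)
qed

text \<open>Passes from the covering of the base to the inclusion of cones, by normalising a nonzero
  vector and scaling back.\<close>

lemma cone_subset_if_norm_base_subset:
  assumes "cone L" "cone D" "0 \<in> D" "norm_base L \<subseteq> D"
  shows "L \<subseteq> D"
proof
  fix x assume x: "x \<in> L"
  show "x \<in> D"
  proof (cases "x = 0")
    case False
    then have "(1 / norm x) *\<^sub>R x \<in> norm_base L"
      using x assms by (auto simp: norm_base_def intro: mem_cone)
    then have "norm x *\<^sub>R (1 / norm x) *\<^sub>R x \<in> D"
      using assms by (blast intro: mem_cone norm_ge_zero)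
    then show ?thesis using False by simp
  qed (use assms in simp)
qed

text \<open>Holds by homogeneity: normalise \<open>a\<close>, take a nearby base point
  \<open>u\<close>, and scale both back by \<open>norm a\<close>, which is at most \<open>R\<close>.
  Since \<open>u\<close> has norm 1, the scaled point has the norm of \<open>a\<close> and stays in
  the ball.\<close>

lemma cone_near_in_cball:
  fixes L D :: "'a::real_normed_vector set"
  assumes "cone L" "cone D" "0 \<in> L" "0 \<le> e" "0 \<le> R" and a: "a \<in> D \<inter> cball 0 R"
    and near: "\<And>a. a \<in> D \<inter> sphere 0 1 \<Longrightarrow> \<exists>b\<in>norm_base L. dist a b \<le> e"
  shows "\<exists>b\<in>L \<inter> cball 0 R. dist a b \<le> R * e"
proof (cases "a = 0")
  case True
  then show ?thesis using assms by (intro bexI[of _ 0]) auto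
next
  case False
  have "(1 / norm a) *\<^sub>R a \<in> D \<inter> sphere 0 1"
    using False a assms(2) by (auto intro: mem_cone)
  then obtain u where u: "u \<in> norm_base L" "dist ((1 / norm a) *\<^sub>R a) u \<le> e"
    using near by blast
  have "a - norm a *\<^sub>R u = norm a *\<^sub>R ((1 / norm a) *\<^sub>R a - u)"
    using False by (simp add: scaleR_diff_right)
  then have "dist a (norm a *\<^sub>R u) = norm a * dist ((1 / norm a) *\<^sub>R a) u"
    by (simp only: dist_norm norm_scaleR abs_norm_cancel)
  also have "\<dots> \<le> R * e"
    using a u assms by (intro mult_mono) auto
  finally show ?thesis
    using a u assms(1) by (intro bexI[of _ "norm a *\<^sub>R u"]) (auto simp: norm_base_def intro: mem_cone)
qed

lemma finite_union_covering_norm_base: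
  fixes \<F> :: "'a::real_normed_vector set set" and L :: "'a set"
  assumes F: "directionally_fine \<F>" and L: "locally_compact_cone L"
    and e: "0 < e" "e < 1"
  obtains D where "finite_union_of_members \<F> D" "norm_base L \<subseteq> D"
    and "\<And>a. a \<in> D \<inter> sphere 0 1 \<Longrightarrow> \<exists>b\<in>norm_base L. dist a b \<le> 2 * e"
proof -
  have "\<exists>C. C \<in> \<F> \<and> u \<in> interior C \<and> C \<subseteq> cone_over (cball u e)" if "u \<in> norm_base L" for u
    using F e that unfolding directionally_fine_def norm_base_def
    by (meson IntD2 greaterThanLessThan_iff)
  then obtain C where C: "\<And>u. u \<in> norm_base L \<Longrightarrow>
      C u \<in> \<F> \<and> u \<in> interior (C u) \<and> C u \<subseteq> cone_over (cball u e)"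
    by metis
  \<comment> \<open>The finite subcover is indexed by centres in the base, so that each centre can
    later serve as the base point close to \<open>a\<close>.\<close>
  obtain K where K: "K \<subseteq> norm_base L" "finite K" "norm_base L \<subseteq> (\<Union>u\<in>K. interior (C u))"
    using compactE_image[OF compact_norm_base[OF L], of "norm_base L" "\<lambda>u. interior (C u)"] C
    by blast
  \<comment> \<open>A proper cone has a nonempty base, which no empty subfamily covers; this rules
    out the empty union.\<close>
  have "K \<noteq> {}"
    using K proper_cone_meets_sphere[of L] L by (auto simp: norm_base_def locally_compact_cone_def)
  then have "finite_union_of_members \<F> (\<Union>(C ` K))"
    using K C unfolding finite_union_of_members_def by (intro exI[of _ "C ` K"]) auto
  moreover have "norm_base L \<subseteq> \<Union>(C ` K)"
    using K interior_subset by blast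
  moreover have "\<exists>b\<in>norm_base L. dist a b \<le> 2 * e" if a: "a \<in> \<Union>(C ` K) \<inter> sphere 0 1" for a
  proof -
    obtain u where u: "u \<in> K" "a \<in> C u" using a by blast
    then have "a \<in> cone_over (cball u e)" "norm u = 1"
      using K C by (blast, auto simp: norm_base_def)
    then have "dist a u \<le> 2 * e"
      using a by (intro dist_cone_over_cball_sphere) auto
    then show ?thesis using u K by blast
  qed
  ultimately show ?thesis by (rule that)
qed

theorem corollary3p22:
  fixes \<F> :: "'a::real_normed_vector set set" and L :: "'a set"
  assumes "directionally_fine \<F>"
    and "locally_compact_cone L"
  shows "(\<forall>\<epsilon>\<in>{0<..<1::real}. \<exists>D. finite_union_of_members \<F> D \<and>
            hausdorff_dist (D \<inter> sphere 0 1) (norm_base L) \<le> 2 * \<epsilon> \<and>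
            (\<forall>R>0. hausdorff_dist (D \<inter> cball 0 R) (L \<inter> cball 0 R) \<le> 2 * R * \<epsilon>)) \<and>
         (\<forall>D :: real \<Rightarrow> 'a set.
            (\<forall>\<epsilon>\<in>{0<..<1}. finite_union_of_members \<F> (D \<epsilon>) \<and>
               hausdorff_dist (D \<epsilon> \<inter> sphere 0 1) (norm_base L) \<le> 2 * \<epsilon> \<and>
               (\<forall>R>0. hausdorff_dist (D \<epsilon> \<inter> cball 0 R) (L \<inter> cball 0 R) \<le> 2 * R * \<epsilon>)) \<longrightarrow>
            ((\<lambda>\<epsilon>. hausdorff_dist (D \<epsilon> \<inter> sphere 0 1) (norm_base L)) \<longlongrightarrow> 0) (at_right 0) \<and>
            (\<forall>R>0. ((\<lambda>\<epsilon>. hausdorff_dist (D \<epsilon> \<inter> cball 0 R) (L \<inter> cball 0 R)) \<longlongrightarrow> 0) (at_right 0)))"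
proof (intro conjI ballI allI impI)
  have L: "proper_cone L" using assms(2) by (simp add: locally_compact_cone_def)
  have members: "\<And>C. C \<in> \<F> \<Longrightarrow> proper_cone C"
    using assms(1) by (simp add: directionally_fine_def)
  \<comment> \<open>Stated for every finite union, since it serves both the \<open>D\<close>
    constructed below and the arbitrary choices in the limit statement.\<close>
  have pos: "D \<inter> sphere 0 1 \<noteq> {}" "0 \<in> D" if D: "finite_union_of_members \<F> D" for D
  proof -
    obtain C where "C \<in> \<F>" "C \<subseteq> D"
      using D unfolding finite_union_of_members_def by blast
    then show "D \<inter> sphere 0 1 \<noteq> {}" "0 \<in> D"
      using proper_cone_meets_sphere[of C] members[of C] by (auto simp: proper_cone_def)
  qed
  {
    fix \<epsilon> :: real assume e: "\<epsilon> \<in> {0<..<1}"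
    obtain D where D: "finite_union_of_members \<F> D" "norm_base L \<subseteq> D"
      and near: "\<And>a. a \<in> D \<inter> sphere 0 1 \<Longrightarrow> \<exists>b\<in>norm_base L. dist a b \<le> 2 * \<epsilon>"
      using finite_union_covering_norm_base[OF assms, of \<epsilon>] e by auto
    have cones: "cone L" "0 \<in> L" "cone D"
      using L cone_finite_union[OF D(1)] members by (auto simp: proper_cone_def)
    have sub: "L \<subseteq> D"
      using cone_subset_if_norm_base_subset[OF cones(1,3) pos(2)[OF D(1)] D(2)] .
    have "hausdorff_dist (D \<inter> sphere 0 1) (norm_base L) \<le> 2 * \<epsilon>"
      using e sub near proper_cone_meets_sphere[OF L]
      by (intro hausdorff_dist_superset_le) (auto simp: norm_base_def)
    moreover have "hausdorff_dist (D \<inter> cball 0 R) (L \<inter> cball 0 R) \<le> 2 * R * \<epsilon>" if R: "R > 0" for R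
    proof (rule hausdorff_dist_superset_le)
      show "L \<inter> cball 0 R \<noteq> {}" using proper_cone_meets_cball[OF L] R by simp
      \<comment> \<open>The bound on unit vectors is \<open>2 * \<epsilon>\<close>, which scaling to
        radius \<open>R\<close> turns into \<open>R * (2 * \<epsilon>)\<close>.\<close>
      show "\<exists>b\<in>L \<inter> cball 0 R. dist a b \<le> 2 * R * \<epsilon>" if "a \<in> D \<inter> cball 0 R" for a
        using cone_near_in_cball[OF cones(1,3,2) _ _ that near] e R by (simp add: mult_ac)
    qed (use sub e R in auto)
    ultimately show "\<exists>D. finite_union_of_members \<F> D \<and>
        hausdorff_dist (D \<inter> sphere 0 1) (norm_base L) \<le> 2 * \<epsilon> \<and>
        (\<forall>R>0. hausdorff_dist (D \<inter> cball 0 R) (L \<inter> cball 0 R) \<le> 2 * R * \<epsilon>)"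
      using D(1) by blast
  }
  fix D :: "real \<Rightarrow> 'a set"
  assume D: "\<forall>\<epsilon>\<in>{0<..<1}. finite_union_of_members \<F> (D \<epsilon>) \<and>
     hausdorff_dist (D \<epsilon> \<inter> sphere 0 1) (norm_base L) \<le> 2 * \<epsilon> \<and>
     (\<forall>R>0. hausdorff_dist (D \<epsilon> \<inter> cball 0 R) (L \<inter> cball 0 R) \<le> 2 * R * \<epsilon>)"
  \<comment> \<open>The estimates are assumed only on the open unit interval, which is a right
    neighbourhood of 0.\<close>
  have ev: "\<forall>\<^sub>F \<epsilon>::real in at_right 0. \<epsilon> \<in> {0<..<1}"
    by (rule eventually_at_right_real) simp
  have lim: "((\<lambda>\<epsilon>. c * \<epsilon>) \<longlongrightarrow> 0) (at_right 0)" for c :: real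
    by (auto intro!: tendsto_eq_intros)
  show "((\<lambda>\<epsilon>. hausdorff_dist (D \<epsilon> \<inter> sphere 0 1) (norm_base L)) \<longlongrightarrow> 0) (at_right 0)"
  proof (rule tendsto_sandwich[OF _ _ tendsto_const lim[of 2]])
    show "\<forall>\<^sub>F \<epsilon> in at_right 0. 0 \<le> hausdorff_dist (D \<epsilon> \<inter> sphere 0 1) (norm_base L)"
      using ev
    proof eventually_elim
      case (elim \<epsilon>)
      then have "D \<epsilon> \<inter> sphere 0 1 \<noteq> {}" using D pos(1) by blast
      then show ?case
        by (intro hausdorff_dist_nonneg boundedI[where B = 1]) auto
    qed
    show "\<forall>\<^sub>F \<epsilon> in at_right 0. hausdorff_dist (D \<epsilon> \<inter> sphere 0 1) (norm_base L) \<le> 2 * \<epsilon>"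
      using ev by eventually_elim (use D in blast)
  qed
  fix R :: real assume R: "R > 0"
  show "((\<lambda>\<epsilon>. hausdorff_dist (D \<epsilon> \<inter> cball 0 R) (L \<inter> cball 0 R)) \<longlongrightarrow> 0) (at_right 0)"
  proof (rule tendsto_sandwich[OF _ _ tendsto_const lim[of "2 * R"]])
    show "\<forall>\<^sub>F \<epsilon> in at_right 0. 0 \<le> hausdorff_dist (D \<epsilon> \<inter> cball 0 R) (L \<inter> cball 0 R)"
      using ev
    proof eventually_elim
      case (elim \<epsilon>)
      then have "0 \<in> D \<epsilon> \<inter> cball 0 R" using D pos(2) R by auto
      then show ?case by (intro hausdorff_dist_nonneg) (auto simp: bounded_Int)
    qed
    show "\<forall>\<^sub>F \<epsilon> in at_right 0. hausdorff_dist (D \<epsilon> \<inter> cball 0 R) (L \<inter> cball 0 R) \<le> 2 * R * \<epsilon>"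
      using ev by eventually_elim (use D R in blast)
  qed
qed

end
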